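(* Let $k$ be a station with access load $\rho_k\in[0,1)$ using Maximum Quantile Scheduling over a window of $W\ge 1$ radio blocks, and let $i$ be a user located at $s_i\in\mathcal{A}_k$ whose SINR at station $k$ has probability density $p_{\gamma,k}(s_i,\cdot)$ on $[0,\infty)$. Let $\pi_{\gamma,k}(s_i,\cdot)$ be the density of the SINR of this user conditioned on the user being scheduled by $k$ (defined in the context). Then for $z\ge 0$ $$\pi_{\gamma,k}(s_i,z)=p_{\gamma,k}(s_i,z)\sum_{n=1}^{W}Q_n(i,z)\,T_k(W,n),$$ where $$Q_n(i,z)=\binom{W-1}{n-1}\left(\int_0^z p_{\gamma,k}(s_i,t)\,dt\right)^{W-n}\left(1-\int_0^z p_{\gamma,k}(s_i,t)\,dt\right)^{n-1},$$ $$T_k(W,n)=\frac{W^2(1-\rho_k)}{\left(W-\rho_k(W-n)\right)^2}.$$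
   Context: Setting: the surface $\mathcal{A}_k$ is the region whose users are served by station $k$. Uplink time is divided into radio blocks (RBs) indexed by $\tau$. For a user at $s$, $\gamma_k(s,\tau)$ is the SINR experienced by $k$ on RB $\tau$. For each user the values $\gamma_k(s,\tau),\gamma_k(s,\tau-1),\dots$ are independent and identically distributed with density $p_{\gamma,k}(s,\cdot)$ (a lognormal density in the model), and the SINR sequences of distinct users are independent. Number of users: let $U$ be the number of users served by $k$, independent of the SINR values, located at $s_1,\dots,s_U$. Conditionally on $U\ge 1$, $\mathbb{P}(U=u\mid U\ge1)=(1-\rho_k)\rho_k^{u-1}$, $u\ge 1$. Maximum Quantile Scheduling (MQS): the ranking $r_i(\tau)\in\{1,\dots,W\}$ of user $i$ is the rank of $\gamma_k(s_i,\tau)$ among the $W$ values $\gamma_k(s_i,\tau-h)$, $h=0,\dots,W-1$, where rank $1$ is the largest value, so that $r_i(\tau)=n$ means that exactly $n-1$ of the other $W-1$ values exceed $\gamma_k(s_i,\tau)$. RB $\tau$ is assigned to the user with the lowest ranking; $f_k(\tau)$ denotes the location of the scheduled user. Ties: $W$ is taken large enough that ties between the rankings of different users are neglected. Concretely, the event $\{f_k(\tau)=s_i\}$ is taken to be the event that all other users have rankings strictly larger than $r_i(\tau)$, while, by fairness, the unconditional probability that a given user is scheduled when $U=u$ is taken to be $1/u$. Conditional density: given $U=u\ge1$, Bayes' rule with these conventions defines $$\pi^{(u)}_{\gamma,k}(s_i,z)=\frac{\mathbb{P}\left(f_k(\tau)=s_i\mid \gamma_k(s_i,\tau)=z,\,U=u\right)\,p_{\gamma,k}(s_i,z)}{1/u},$$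 and $\pi_{\gamma,k}(s_i,z)=\sum_{u\ge 1}\mathbb{P}(U=u\mid U\ge 1)\,\pi^{(u)}_{\gamma,k}(s_i,z)$. The convention $0^0=1$ is used. *)

theory Defs
  imports "HOL-Probability.Probability"
begin

section \<open>The uplink of one station\<close>

text \<open>
  A station is fixed throughout, so the index \<open>k\<close> is suppressed. Users carry labels:
  user \<open>j\<close> sits at \<open>loc j\<close> and \<open>\<gamma> j t\<close> is its SINR on RB \<open>t\<close>. \<open>served u\<close> is the set of labels
  of the \<open>u\<close> users served when \<open>U = u\<close>. Using labels instead of \<open>1, \<dots>, u\<close> allows one and the same
  user to be followed through all values of \<open>u\<close>, as is needed to average over \<open>U\<close>.
\<close>

locale uplink_station = prob_space M
  for M :: "'w measure"
    and A :: "'loc set"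
    and p :: "'loc \<Rightarrow> real \<Rightarrow> real"
    and \<rho> :: real
    and loc :: "'user \<Rightarrow> 'loc"
    and \<gamma> :: "'user \<Rightarrow> int \<Rightarrow> 'w \<Rightarrow> real"
    and U :: "'w \<Rightarrow> nat"
    and served :: "nat \<Rightarrow> 'user set" +
  assumes loc_in: "\<And>j. loc j \<in> A"
    and density_nonneg: "\<And>s x. s \<in> A \<Longrightarrow> 0 \<le> p s x"
    and density_support: "\<And>s x. s \<in> A \<Longrightarrow> x < 0 \<Longrightarrow> p s x = 0"
    and SINR_distributed: "\<And>j t. distributed M lborel (\<gamma> j t) (\<lambda>x. ennreal (p (loc j) x))"
    and SINR_indep: "indep_vars (\<lambda>_. borel) (\<lambda>(j, t). \<gamma> j t) UNIV"
    and U_measurable: "U \<in> measurable M (count_space UNIV)"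
    and U_indep_SINR:
      "indep_set (sets (vimage_algebra (space M) U (count_space UNIV)))
         (sets (vimage_algebra (space M) (\<lambda>\<omega> (j, t). \<gamma> j t \<omega>)
           (Pi\<^sub>M (UNIV :: ('user \<times> int) set) (\<lambda>_. borel))))"
    and U_law: "\<And>u. 1 \<le> u \<Longrightarrow>
      \<P>(\<omega> in M. U \<omega> = u \<bar> 1 \<le> U \<omega>) = (1 - \<rho>) * \<rho> ^ (u - 1)"
    and served_card: "\<And>u. 1 \<le> u \<Longrightarrow> finite (served u) \<and> card (served u) = u"


section \<open>Maximum Quantile Scheduling\<close>

definition mqs_rank :: "nat \<Rightarrow> (int \<Rightarrow> real) \<Rightarrow> int \<Rightarrow> nat" where
  "mqs_rank W g \<tau> = 1 + card {h \<in> {1..<W}. g (\<tau> - int h) > g \<tau>}"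

text \<open>Ties between different users are resolved against user \<open>i\<close>: all other rankings must be
  strictly larger.\<close>

definition mqs_scheduled ::
    "nat \<Rightarrow> int \<Rightarrow> 'user set \<Rightarrow> 'user \<Rightarrow> ('user \<Rightarrow> int \<Rightarrow> real) \<Rightarrow> bool" where
  "mqs_scheduled W \<tau> S i x \<longleftrightarrow> (\<forall>j \<in> S - {i}. mqs_rank W (x i) \<tau> < mqs_rank W (x j) \<tau>)"


section \<open>The probability of being scheduled, given the SINR\<close>

text \<open>
  \<open>c\<close> is a version of \<open>z \<mapsto> P(E \<bar> X = z)\<close> under the probability measure \<open>N\<close>: \<open>c\<close> composed with \<open>X\<close> is the
  conditional expectation of the indicator of \<open>E\<close> given the sigma-algebra generated by \<open>X\<close>.
\<close>

definition is_cond_prob_given ::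
    "'w measure \<Rightarrow> ('w \<Rightarrow> real) \<Rightarrow> 'w set \<Rightarrow> (real \<Rightarrow> real) \<Rightarrow> bool" where
  "is_cond_prob_given N X E c \<longleftrightarrow>
     c \<in> borel_measurable borel \<and>
     (AE \<omega> in N. c (X \<omega>) =
        real_cond_exp N (vimage_algebra (space N) X borel) (indicator E) \<omega>)"

text \<open>
  \<open>c u z\<close> is a version of the probability that user \<open>i\<close> is scheduled on RB \<open>\<tau>\<close> given \<open>\<gamma> i \<tau> = z\<close> and
  \<open>U = u\<close>. Where \<open>U = u\<close> has probability zero, the uniform measure is the null measure, so the
  condition is only measurability of \<open>c u\<close>; such \<open>u\<close> get weight zero in \<open>scheduled_density\<close>.
\<close>

definition is_sched_prob ::
    "'w measure \<Rightarrow> ('user \<Rightarrow> int \<Rightarrow> 'w \<Rightarrow> real) \<Rightarrow> ('w \<Rightarrow> nat) \<Rightarrow> (nat \<Rightarrow> 'user set) \<Rightarrow>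
     nat \<Rightarrow> int \<Rightarrow> 'user \<Rightarrow> (nat \<Rightarrow> real \<Rightarrow> real) \<Rightarrow> bool" where
  "is_sched_prob M \<gamma> U served W \<tau> i c \<longleftrightarrow>
     (\<forall>u \<ge> 1. is_cond_prob_given (uniform_measure M {\<omega> \<in> space M. U \<omega> = u}) (\<gamma> i \<tau>)
        {\<omega> \<in> space M. mqs_scheduled W \<tau> (served u) i (\<lambda>j t. \<gamma> j t \<omega>)} (c u))"

text \<open>
  A version that is determined at every single \<open>z\<close>: since \<open>\<gamma> i \<tau>\<close> is independent of \<open>U\<close> and of all
  other SINR values, conditioning on \<open>\<gamma> i \<tau> = z\<close> fixes this one value to \<open>z\<close> and leaves the joint
  law of the others unchanged.
\<close>

definition sched_prob ::
    "'w measure \<Rightarrow> ('user \<Rightarrow> int \<Rightarrow> 'w \<Rightarrow> real) \<Rightarrow> ('w \<Rightarrow> nat) \<Rightarrow> (nat \<Rightarrow> 'user set) \<Rightarrow>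
     nat \<Rightarrow> int \<Rightarrow> 'user \<Rightarrow> nat \<Rightarrow> real \<Rightarrow> real" where
  "sched_prob M \<gamma> U served W \<tau> i u z =
     \<P>(\<omega> in M. mqs_scheduled W \<tau> (served u) i
                 ((\<lambda>j t. \<gamma> j t \<omega>)(i := (\<lambda>t. \<gamma> i t \<omega>)(\<tau> := z)))
            \<bar> U \<omega> = u)"


section \<open>The SINR density of a scheduled user\<close>

text \<open>
  Both definitions take the conditional scheduling probability \<open>c u z\<close> as a parameter; \<open>q\<close> is the
  unconditional SINR density of the user. The denominator \<open>1 / u\<close> is the fairness convention for
  the unconditional probability of being scheduled.
\<close>

definition scheduled_density_given :: "(nat \<Rightarrow> real \<Rightarrow> real) \<Rightarrow> (real \<Rightarrow> real) \<Rightarrow> nat \<Rightarrow> real \<Rightarrow> real"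
  where "scheduled_density_given c q u z = c u z * q z / (1 / real u)"

definition scheduled_density ::
    "'w measure \<Rightarrow> ('w \<Rightarrow> nat) \<Rightarrow> (nat \<Rightarrow> real \<Rightarrow> real) \<Rightarrow> (real \<Rightarrow> real) \<Rightarrow> real \<Rightarrow> real" where
  "scheduled_density M U c q z =
     (\<Sum>\<^sub>\<infinity>u\<in>{1..}. \<P>(\<omega> in M. U \<omega> = u \<bar> 1 \<le> U \<omega>) * scheduled_density_given c q u z)"

definition Q_coeff :: "(real \<Rightarrow> real) \<Rightarrow> nat \<Rightarrow> nat \<Rightarrow> real \<Rightarrow> real" where
  "Q_coeff q W n z =
     real ((W - 1) choose (n - 1)) * (LINT t:{0..z}|lborel. q t) ^ (W - n)
       * (1 - (LINT t:{0..z}|lborel. q t)) ^ (n - 1)"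

definition T_coeff :: "real \<Rightarrow> nat \<Rightarrow> nat \<Rightarrow> real" where
  "T_coeff \<rho> W n = (real W)\<^sup>2 * (1 - \<rho>) / (real W - \<rho> * (real W - real n))\<^sup>2"

end

theory Submission
  imports Defs
begin

text \<open>
  Fix \<open>U = u\<close> and freeze the current SINR of user \<open>i\<close> at \<open>z\<close>. Each of the \<open>W - 1\<close> past values of
  user \<open>i\<close> exceeds \<open>z\<close> independently with probability \<open>1 - \<integral>\<^sub>0\<^sup>z p\<close>, so the rank of \<open>i\<close> equals
  \<open>n\<close> with the binomial probability \<open>Q\<^sub>n\<close>. The rank of any other user is uniform on \<open>{1..W}\<close>,
  because its \<open>W\<close> values are exchangeable and almost surely distinct; it exceeds \<open>n\<close> with
  probability \<open>(W - n) / W\<close>. As users are independent, \<open>i\<close> is scheduled with probability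
  \<open>\<Sum>n. Q\<^sub>n ((W - n) / W)\<^sup>u\<^sup>-\<^sup>1\<close>. Averaging \<open>u\<close> times this over the geometric law of \<open>U\<close> differentiates
  a geometric series, which yields \<open>T\<close>. Freezing the SINR gives a version of the conditional
  probability by independence and Fubini's theorem.
\<close>

section \<open>Independent and exchangeable random variables\<close>

text \<open>Each \<open>X (f j)\<close> is recovered from the block of the family over the singleton
  \<open>{f j}\<close>; injectivity makes these blocks disjoint, and disjoint blocks are
  independent.\<close>

lemma (in prob_space) indep_vars_reindex:
  assumes indep: "indep_vars N X I" and f: "f ` J \<subseteq> I" "inj_on f J"
  shows "indep_vars (\<lambda>j. N (f j)) (\<lambda>j. X (f j)) J"
proof -
  have "indep_vars (\<lambda>j. PiM {f j} N) (\<lambda>j \<omega>. restrict (\<lambda>i. X i \<omega>) {f j}) J"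
    using f by (intro indep_vars_restrict[OF indep]) (auto simp: disjoint_family_on_def inj_on_def)
  then have "indep_vars (\<lambda>j. N (f j)) (\<lambda>j \<omega>. (restrict (\<lambda>i. X i \<omega>) {f j}) (f j)) J"
    by (rule indep_vars_compose2) simp
  then show ?thesis by simp
qed

lemma (in prob_space) indep_vars_imp_indep_var:
  assumes indep: "indep_vars N X I" and kl: "k \<in> I" "l \<in> I" "k \<noteq> l"
  shows "indep_var (N k) (X k) (N l) (X l)"
proof -
  have "indep_var (PiM {k} N) (\<lambda>\<omega>. restrict (\<lambda>i. X i \<omega>) {k})
      (PiM {l} N) (\<lambda>\<omega>. restrict (\<lambda>i. X i \<omega>) {l})"
    using kl by (intro indep_var_restrict[OF indep]) auto
  then have "indep_var (N k) ((\<lambda>x. x k) \<circ> (\<lambda>\<omega>. restrict (\<lambda>i. X i \<omega>) {k}))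
      (N l) ((\<lambda>x. x l) \<circ> (\<lambda>\<omega>. restrict (\<lambda>i. X i \<omega>) {l}))"
    by (rule indep_var_compose) simp_all
  then show ?thesis by (simp add: comp_def)
qed

text \<open>The binomial law: the event splits according to the exact set \<open>S\<close> of
  indices that hit \<open>B\<close>. Independence gives every such pattern the same probability, and
  there are \<open>card I choose m\<close> of them.\<close>

lemma (in prob_space) prob_card_indep_events:
  assumes indep: "indep_vars (\<lambda>_. N) X I" and fin: "finite I" and B: "B \<in> sets N"
    and q: "\<And>h. h \<in> I \<Longrightarrow> prob (X h -` B \<inter> space M) = q"
  shows "prob {\<omega> \<in> space M. card {h \<in> I. X h \<omega> \<in> B} = m}
    = real (card I choose m) * q ^ m * (1 - q) ^ (card I - m)"
proof -
  have X: "X h \<in> measurable M N" if "h \<in> I" for h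
    using indep that by (auto simp: indep_vars_def)
  have compl: "X h -` (space N - B) \<inter> space M = space M - (X h -` B \<inter> space M)" if "h \<in> I" for h
    using measurable_space[OF X[OF that]] by auto
  have pattern: "{\<omega> \<in> space M. {h \<in> I. X h \<omega> \<in> B} = S} \<in> events \<and>
      prob {\<omega> \<in> space M. {h \<in> I. X h \<omega> \<in> B} = S} = q ^ card S * (1 - q) ^ (card I - card S)"
    if S: "S \<subseteq> I" for S
  proof (cases "I = {}")
    \<comment> \<open>An intersection over the empty index set would be \<open>UNIV\<close> instead
      of \<open>space M\<close>, so this case stands apart.\<close>
    case True
    then have "{\<omega> \<in> space M. {h \<in> I. X h \<omega> \<in> B} = S} = space M" using S by auto
    then show ?thesis using True S prob_space by simp
  next
    case False
    let ?C = "\<lambda>h. if h \<in> S then B else space N - B"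
    have eq: "{\<omega> \<in> space M. {h \<in> I. X h \<omega> \<in> B} = S} = (\<Inter>h\<in>I. X h -` ?C h \<inter> space M)"
      using S False measurable_space[OF X] by (fastforce split: if_splits)
    have "prob (\<Inter>h\<in>I. X h -` ?C h \<inter> space M) = (\<Prod>h\<in>I. prob (X h -` ?C h \<inter> space M))"
      using indep fin False B by (intro indep_varsD[where M' = "\<lambda>_. N"]) auto
    also have "\<dots> = (\<Prod>h\<in>I. if h \<in> S then q else 1 - q)"
      using B X by (intro prod.cong refl) (auto simp: q compl prob_compl measurable_sets)
    also have "\<dots> = q ^ card S * (1 - q) ^ (card I - card S)"
      using S fin by (simp add: prod.If_cases Int_absorb1 Diff_eq[symmetric] card_Diff_subset finite_subset)
    finally show ?thesis
      unfolding eq using X B fin False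
      by (intro conjI sets.finite_INT) (auto intro!: measurable_sets[OF X])
  qed
  have "{\<omega> \<in> space M. card {h \<in> I. X h \<omega> \<in> B} = m}
      = (\<Union>S\<in>{S. S \<subseteq> I \<and> card S = m}. {\<omega> \<in> space M. {h \<in> I. X h \<omega> \<in> B} = S})"
    by auto
  also have "prob \<dots> = (\<Sum>S\<in>{S. S \<subseteq> I \<and> card S = m}. prob {\<omega> \<in> space M. {h \<in> I. X h \<omega> \<in> B} = S})"
    using fin pattern by (intro finite_measure_finite_Union) (auto simp: disjoint_family_on_def)
  also have "\<dots> = (\<Sum>S\<in>{S. S \<subseteq> I \<and> card S = m}. q ^ m * (1 - q) ^ (card I - m))"
    using pattern by (intro sum.cong) auto
  also have "\<dots> = real (card I choose m) * q ^ m * (1 - q) ^ (card I - m)"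
    using n_subsets[OF fin] by simp
  finally show ?thesis .
qed

text \<open>By independence the joint law is a product, and by Fubini it is enough that, for each
  fixed value \<open>x\<close> of \<open>X\<close>, the law of \<open>Y\<close> gives no mass to
  \<open>{x}\<close>.\<close>

lemma (in prob_space) indep_atomless_AE_neq:
  fixes X Y :: "'a \<Rightarrow> real"
  assumes indep: "indep_var borel X borel Y"
    and atomless: "\<And>x. prob (Y -` {x} \<inter> space M) = 0"
  shows "AE \<omega> in M. X \<omega> \<noteq> Y \<omega>"
proof -
  note rv = indep_var_rv1[OF indep] indep_var_rv2[OF indep]
  note [measurable] = rv
  interpret X: prob_space "distr M borel X" by (rule prob_space_distr) fact
  interpret Y: prob_space "distr M borel Y" by (rule prob_space_distr) fact
  interpret XY: pair_sigma_finite "distr M borel X" "distr M borel Y" ..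
  have "AE xy in distr M borel X \<Otimes>\<^sub>M distr M borel Y. fst xy \<noteq> snd xy"
  proof (rule XY.AE_pair_measure)
    show "{xy \<in> space (distr M borel X \<Otimes>\<^sub>M distr M borel Y). fst xy \<noteq> snd xy}
        \<in> sets (distr M borel X \<Otimes>\<^sub>M distr M borel Y)"
      by measurable
    have "AE y in distr M borel Y. x \<noteq> y" for x
    proof (rule AE_I[where N = "{x}"])
      show "emeasure (distr M borel Y) {x} = 0"
        using atomless[of x] by (simp add: emeasure_distr emeasure_eq_measure)
    qed auto
    then show "AE x in distr M borel X. AE y in distr M borel Y. fst (x, y) \<noteq> snd (x, y)"
      by simp
  qed
  then have "AE xy in distr M (borel \<Otimes>\<^sub>M borel) (\<lambda>\<omega>. (X \<omega>, Y \<omega>)). fst xy \<noteq> snd xy"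
    using indep unfolding indep_var_distribution_eq by (elim conjE) (simp only:)
  then show ?thesis
    by (subst (asm) AE_distr_iff) auto
qed

text \<open>Without ties, counting the larger entries is an injection of \<open>I\<close> into
  \<open>{..<card I}\<close>, hence a bijection, so each count from \<open>n\<close> to
  \<open>card I - 1\<close> occurs exactly once.\<close>

lemma card_rank_ge:
  fixes g :: "'i \<Rightarrow> 'a::linorder"
  assumes fin: "finite I" and inj: "inj_on g I"
  shows "card {a \<in> I. n \<le> card {k \<in> I. g a < g k}} = card I - n"
proof -
  let ?r = "\<lambda>a. card {k \<in> I. g a < g k}"
  have strict: "?r b < ?r a" if "a \<in> I" "b \<in> I" "g a < g b" for a b
    using fin that by (intro psubset_card_mono) auto
  have inj_r: "inj_on ?r I"
    using strict inj by (metis (no_types, lifting) inj_on_def less_irrefl neqE)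
  have "?r ` I \<subseteq> {..<card I}"
    using fin by (auto intro!: psubset_card_mono)
  then have r: "?r ` I = {..<card I}"
    using card_image[OF inj_r] by (intro card_subset_eq) auto
  have "card {a \<in> I. n \<le> ?r a} = card (?r ` {a \<in> I. n \<le> ?r a})"
    by (rule card_image[symmetric], rule inj_on_subset[OF inj_r]) auto
  also have "?r ` {a \<in> I. n \<le> ?r a} = {n..<card I}"
    using r by (auto simp: image_iff set_eq_iff) metis
  finally show ?thesis by simp
qed

text \<open>Exchangeability: independence makes both joint laws products, and all the factors equal
  \<open>D\<close>.\<close>

lemma (in prob_space) iid_permute:
  assumes indep: "indep_vars (\<lambda>_. N) X I"
    and D: "\<And>k. k \<in> I \<Longrightarrow> distr M N (X k) = D"
    and \<pi>: "\<pi> permutes I"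
  shows "distr M (\<Pi>\<^sub>M k\<in>I. N) (\<lambda>\<omega>. \<lambda>k\<in>I. X (\<pi> k) \<omega>) = distr M (\<Pi>\<^sub>M k\<in>I. N) (\<lambda>\<omega>. \<lambda>k\<in>I. X k \<omega>)"
proof (cases "I = {}")
  case False
  have rv: "X k \<in> measurable M N" if "k \<in> I" for k
    using indep that by (auto simp: indep_vars_def)
  have in_I: "\<pi> k \<in> I" if "k \<in> I" for k
    using \<pi> that by (simp add: permutes_in_image)
  have "indep_vars (\<lambda>_. N) (X \<circ> \<pi>) I"
    using indep_vars_reindex[OF indep, of \<pi> I] \<pi>
    by (simp add: comp_def permutes_image permutes_inj_on)
  then have "distr M (\<Pi>\<^sub>M k\<in>I. N) (\<lambda>\<omega>. \<lambda>k\<in>I. X (\<pi> k) \<omega>) = (\<Pi>\<^sub>M k\<in>I. distr M N (X (\<pi> k)))"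
    using False rv in_I by (subst (asm) indep_vars_iff_distr_eq_PiM') (auto simp: comp_def)
  also have "\<dots> = (\<Pi>\<^sub>M k\<in>I. distr M N (X k))"
    using D in_I by (intro PiM_cong) auto
  also have "\<dots> = distr M (\<Pi>\<^sub>M k\<in>I. N) (\<lambda>\<omega>. \<lambda>k\<in>I. X k \<omega>)"
    using indep False rv by (subst (asm) indep_vars_iff_distr_eq_PiM') auto
  finally show ?thesis .
qed (simp add: restrict_def)

text \<open>By exchangeability the probability is the same for every index \<open>b\<close> in place
  of \<open>a\<close>. The number of indices whose event occurs is almost surely the constant
  \<open>card I - n\<close>, so taking expectations determines the common value.\<close>

lemma (in prob_space) iid_rank_uniform:
  fixes X :: "nat \<Rightarrow> 'a \<Rightarrow> real"
  assumes indep: "indep_vars (\<lambda>_. borel) X I" and fin: "finite I" and a: "a \<in> I"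
    and D: "\<And>k. k \<in> I \<Longrightarrow> distr M borel (X k) = D"
    and atomless: "\<And>x. emeasure D {x} = 0"
  shows "prob {\<omega> \<in> space M. n \<le> card {k \<in> I. X a \<omega> < X k \<omega>}} = real (card I - n) / real (card I)"
proof -
  have X[measurable]: "X k \<in> borel_measurable M" if "k \<in> I" for k
    using indep that by (auto simp: indep_vars_def)
  let ?R = "\<lambda>b. {\<omega> \<in> space M. n \<le> card {k \<in> I. X b \<omega> < X k \<omega>}}"
  have ev[measurable]: "?R b \<in> events" if "b \<in> I" for b
  proof -
    have [measurable]: "{\<omega> \<in> space M. k \<in> {k \<in> I. X b \<omega> < X k \<omega>}} \<in> events" for k
      using X that by (cases "k \<in> I") auto
    show ?thesis by measurable
  qed
  have same: "prob (?R b) = prob (?R a)" if b: "b \<in> I" for b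
  proof -
    \<comment> \<open>Swapping \<open>a\<close> and \<open>b\<close> moves \<open>X b\<close> to
      coordinate \<open>a\<close>, the only coordinate whose rank the set \<open>S\<close> below
      tests.\<close>
    define \<pi> where "\<pi> = Transposition.transpose a b"
    have \<pi>: "\<pi> permutes I" unfolding \<pi>_def using a b by (simp add: permutes_swap_id)
    let ?P = "\<Pi>\<^sub>M k\<in>I. (borel :: real measure)"
    define S where "S = {x \<in> space ?P. n \<le> card {k \<in> I. x a < x k}}"
    have S: "S \<in> sets ?P"
    proof -
      have [measurable]: "{x \<in> space ?P. k \<in> {k \<in> I. x a < x k}} \<in> sets ?P" for k
        using a by (cases "k \<in> I") auto
      show ?thesis unfolding S_def by measurable
    qed
    have in_I: "\<pi> k \<in> I" if "k \<in> I" for k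
      using \<pi> that by (simp add: permutes_in_image)
    have meas: "(\<lambda>\<omega>. \<lambda>k\<in>I. X (\<sigma> k) \<omega>) \<in> measurable M ?P" if "\<sigma> permutes I" for \<sigma>
      using X that by (auto intro!: measurable_restrict simp: permutes_in_image)
    \<comment> \<open>Permuting the competitors does not change how many of them are larger. The
      claim is used for \<open>\<pi>\<close> and for the identity.\<close>
    have pre: "(\<lambda>\<omega>. \<lambda>k\<in>I. X (\<sigma> k) \<omega>) -` S \<inter> space M = ?R (\<sigma> a)" if \<sigma>: "\<sigma> permutes I" for \<sigma>
    proof -
      have "card {k \<in> I. X (\<sigma> a) \<omega> < X (\<sigma> k) \<omega>} = card {k \<in> I. X (\<sigma> a) \<omega> < X k \<omega>}" for \<omega>
      proof -
        have "\<sigma> ` {k \<in> I. X (\<sigma> a) \<omega> < X (\<sigma> k) \<omega>} = {k \<in> I. X (\<sigma> a) \<omega> < X k \<omega>}"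
          using permutes_image[OF \<sigma>] by (auto simp: set_eq_iff image_iff) (metis permutes_in_image[OF \<sigma>])+
        then show ?thesis
          using card_image[OF inj_on_subset[OF permutes_inj[OF \<sigma>] subset_UNIV]] by metis
      qed
      moreover have "{k \<in> I. (\<lambda>k\<in>I. X (\<sigma> k) \<omega>) a < (\<lambda>k\<in>I. X (\<sigma> k) \<omega>) k}
          = {k \<in> I. X (\<sigma> a) \<omega> < X (\<sigma> k) \<omega>}" for \<omega>
        using a by auto
      ultimately show ?thesis
        by (auto simp: S_def space_PiM)
    qed
    have "prob (?R b) = measure (distr M ?P (\<lambda>\<omega>. \<lambda>k\<in>I. X (\<pi> k) \<omega>)) S"
      using S meas[OF \<pi>] pre[OF \<pi>] by (simp add: measure_distr \<pi>_def)
    also have "\<dots> = measure (distr M ?P (\<lambda>\<omega>. \<lambda>k\<in>I. X k \<omega>)) S"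
      by (simp add: iid_permute[OF indep D \<pi>])
    also have "\<dots> = prob (?R a)"
      using S meas[OF permutes_id] pre[OF permutes_id] by (simp add: measure_distr)
    finally show ?thesis .
  qed
  have "AE \<omega> in M. X k \<omega> \<noteq> X l \<omega>" if "k \<in> I" "l \<in> I" "k \<noteq> l" for k l
  proof (rule indep_atomless_AE_neq)
    show "indep_var borel (X k) borel (X l)"
      using indep that by (rule indep_vars_imp_indep_var[where N = "\<lambda>_. borel"])
    show "prob (X l -` {x} \<inter> space M) = 0" for x
      using atomless[of x] X[OF that(2)] D[OF that(2)]
      by (metis borel_singleton emeasure_distr measure_eq_emeasure_eq_ennreal ennreal_0 order_refl sets.empty_sets)
  qed
  then have "AE \<omega> in M. \<forall>k\<in>I. \<forall>l\<in>I. k \<noteq> l \<longrightarrow> X k \<omega> \<noteq> X l \<omega>"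
    using fin by (simp add: AE_ball_countable countable_finite)
  then have inj: "AE \<omega> in M. inj_on (\<lambda>k. X k \<omega>) I"
    by eventually_elim (auto simp: inj_on_def)
  \<comment> \<open>Double counting: the sum of the probabilities is the expected number of indices
    with at least \<open>n\<close> larger values.\<close>
  have "real (card I) * prob (?R a) = (\<Sum>b\<in>I. prob (?R b))"
    using same by simp
  also have "\<dots> = expectation (\<lambda>\<omega>. \<Sum>b\<in>I. indicator (?R b) \<omega>)"
    using ev by (subst Bochner_Integration.integral_sum) (auto simp: integrable_indicator_iff less_top[symmetric])
  also have "\<dots> = expectation (\<lambda>\<omega>. real (card I - n))"
  proof (rule integral_cong_AE)
    have count: "(\<Sum>b\<in>I. indicator (?R b) \<omega>) = real (card I - n)"
      if "\<omega> \<in> space M" "inj_on (\<lambda>k. X k \<omega>) I" for \<omega>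
    proof -
      have "(\<Sum>b\<in>I. indicator (?R b) \<omega>) = real (card {b \<in> I. n \<le> card {k \<in> I. X b \<omega> < X k \<omega>}})"
        using fin that by (simp add: indicator_def sum.If_cases Int_def)
      then show ?thesis using card_rank_ge[OF fin that(2)] by simp
    qed
    show "AE \<omega> in M. (\<Sum>b\<in>I. indicator (?R b) \<omega>) = real (card I - n)"
      using inj AE_space by eventually_elim (rule count)
  qed auto
  also have "\<dots> = real (card I - n)" by (simp add: prob_space)
  finally have "real (card I) * prob (?R a) = real (card I - n)" .
  moreover have "real (card I) \<noteq> 0" using a fin by auto
  ultimately show ?thesis by (simp add: eq_divide_eq mult.commute)
qed

text \<open>Fubini for the product law of \<open>(X, Y)\<close>, with both marginal integrals pulled
  back to \<open>M\<close>. The inner expectation holds the value of \<open>X\<close> fixed while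
  \<open>Y\<close> is redrawn.\<close>

lemma (in prob_space) indep_var_expectation_freeze:
  fixes f :: "'b \<times> 'b \<Rightarrow> real"
  assumes indep: "indep_var S X T Y"
    and f: "f \<in> borel_measurable (S \<Otimes>\<^sub>M T)"
    and int: "integrable M (\<lambda>\<omega>. f (X \<omega>, Y \<omega>))"
  shows "expectation (\<lambda>\<omega>. f (X \<omega>, Y \<omega>)) = expectation (\<lambda>\<omega>. expectation (\<lambda>\<omega>'. f (X \<omega>, Y \<omega>')))"
proof -
  note rv = indep_var_rv1[OF indep] indep_var_rv2[OF indep]
  note [measurable] = rv f
  interpret X: prob_space "distr M S X" by (rule prob_space_distr) fact
  interpret Y: prob_space "distr M T Y" by (rule prob_space_distr) fact
  interpret XY: pair_sigma_finite "distr M S X" "distr M T Y" ..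
  have eq: "distr M (S \<Otimes>\<^sub>M T) (\<lambda>\<omega>. (X \<omega>, Y \<omega>)) = distr M S X \<Otimes>\<^sub>M distr M T Y"
    using indep unfolding indep_var_distribution_eq by (elim conjE) (simp only:)
  have "integrable (distr M (S \<Otimes>\<^sub>M T) (\<lambda>\<omega>. (X \<omega>, Y \<omega>))) f"
    using int by (subst integrable_distr_eq) auto
  then have int': "integrable (distr M S X \<Otimes>\<^sub>M distr M T Y) f"
    by (simp only: eq)
  have "expectation (\<lambda>\<omega>. f (X \<omega>, Y \<omega>)) = integral\<^sup>L (distr M S X \<Otimes>\<^sub>M distr M T Y) f"
    by (subst eq[symmetric], subst integral_distr) auto
  also have "\<dots> = (LINT x|distr M S X. LINT y|distr M T Y. f (x, y))"
    using XY.integral_fst'[OF int'] by simp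
  also have "\<dots> = (LINT \<omega>|M. LINT y|distr M T Y. f (X \<omega>, y))"
    by (subst integral_distr) auto
  also have "\<dots> = expectation (\<lambda>\<omega>. expectation (\<lambda>\<omega>'. f (X \<omega>, Y \<omega>')))"
    by (intro Bochner_Integration.integral_cong refl integral_distr)
      (auto intro!: measurable_compose[OF _ f] dest: measurable_space[OF rv(1)])
  finally show ?thesis .
qed

section \<open>Geometric averages\<close>

lemma has_sum_geometric_deriv:
  fixes x :: real
  assumes "0 \<le> x" "x < 1"
  shows "((\<lambda>u. real u * x ^ (u - 1)) has_sum 1 / (1 - x)\<^sup>2) {1..}"
proof -
  have "(\<lambda>n. real (Suc n) * x ^ n) sums (1 / (1 - x)\<^sup>2)"
    using geometric_deriv_sums[of x] assms by simp
  \<comment> \<open>The terms are nonnegative, so convergence of the series is absolute and passes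
    to the unordered sum.\<close>
  then have "((\<lambda>n. real (Suc n) * x ^ n) has_sum 1 / (1 - x)\<^sup>2) UNIV"
    using assms by (intro norm_summable_imp_has_sum) (auto simp: sums_iff)
  moreover have "((\<lambda>u. real u * x ^ (u - 1)) has_sum s) (range Suc)
      \<longleftrightarrow> ((\<lambda>n. real (Suc n) * x ^ n) has_sum s) UNIV" for s
    by (subst has_sum_reindex) (auto simp: comp_def)
  moreover have "range Suc = {1..}"
    by (auto simp: image_iff Suc_le_eq gr0_conv_Suc)
  ultimately show ?thesis by simp
qed

lemma has_sum_sum:
  fixes f :: "'i \<Rightarrow> 'a \<Rightarrow> real"
  assumes "\<And>i. i \<in> I \<Longrightarrow> (f i has_sum s i) A"
  shows "((\<lambda>x. \<Sum>i\<in>I. f i x) has_sum (\<Sum>i\<in>I. s i)) A"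
  using assms by (induction I rule: infinite_finite_induct) (auto intro: has_sum_add has_sum_0)

text \<open>The two powers merge into one with base \<open>x = \<rho> * (W - n) / W\<close>, and
  \<open>1 - x\<close> is the denominator of \<open>T_coeff\<close> before squaring, divided by
  \<open>W\<close>. For \<open>n = W\<close> the base is 0, and \<open>0 ^ 0 = 1\<close> keeps the
  term \<open>u = 1\<close>.\<close>

lemma T_coeff_has_sum:
  assumes \<rho>: "0 \<le> \<rho>" "\<rho> < 1" and n: "1 \<le> n" "n \<le> W"
  shows "((\<lambda>u. (1 - \<rho>) * \<rho> ^ (u - 1) * (real u * (real (W - n) / real W) ^ (u - 1)))
    has_sum T_coeff \<rho> W n) {1..}"
proof -
  let ?x = "\<rho> * (real (W - n) / real W)"
  have "?x \<le> \<rho> * 1" using \<rho> n by (intro mult_left_mono) auto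
  then have x: "0 \<le> ?x" "?x < 1" using \<rho> by auto
  have "((\<lambda>u. (1 - \<rho>) * (real u * ?x ^ (u - 1))) has_sum (1 - \<rho>) * (1 / (1 - ?x)\<^sup>2)) {1..}"
    by (intro has_sum_cmult_right has_sum_geometric_deriv x)
  moreover have "(1 - \<rho>) * (1 / (1 - ?x)\<^sup>2) = T_coeff \<rho> W n"
  proof -
    have "1 - ?x = (real W - \<rho> * (real W - real n)) / real W"
      using n by (simp add: field_simps)
    then show ?thesis
      by (simp add: T_coeff_def power_divide)
  qed
  moreover have "(1 - \<rho>) * (real u * ?x ^ (u - 1))
      = (1 - \<rho>) * \<rho> ^ (u - 1) * (real u * (real (W - n) / real W) ^ (u - 1))" for u
    by (simp only: power_mult_distrib) (simp only: mult_ac)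
  ultimately show ?thesis by (simp only:)
qed

section \<open>Ranks\<close>

text \<open>The rank minus one, with the threshold separated from the history: a frozen value and a
  genuine current value are then treated alike.\<close>

definition exceedances :: "nat \<Rightarrow> int \<Rightarrow> (int \<Rightarrow> real) \<Rightarrow> real \<Rightarrow> nat" where
  "exceedances W \<tau> g z = card {h \<in> {1..<W}. z < g (\<tau> - int h)}"

lemma exceedances_le: "exceedances W \<tau> g z \<le> W - 1"
  using card_mono[of "{1..<W}" "{h \<in> {1..<W}. z < g (\<tau> - int h)}"]
  unfolding exceedances_def card_atLeastLessThan by blast

lemma mqs_rank_eq: "mqs_rank W g \<tau> = Suc (exceedances W \<tau> g (g \<tau>))"
  by (simp add: mqs_rank_def exceedances_def)

text \<open>The count looks only at strictly earlier blocks, so overwriting the value at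
  \<open>\<tau>\<close> affects nothing but the threshold.\<close>

lemma mqs_rank_upd: "mqs_rank W (g(\<tau> := z)) \<tau> = Suc (exceedances W \<tau> g z)"
proof -
  have "{h \<in> {1..<W}. (g(\<tau> := z)) \<tau> < (g(\<tau> := z)) (\<tau> - int h)} = {h \<in> {1..<W}. z < g (\<tau> - int h)}"
    by auto
  then show ?thesis by (simp add: mqs_rank_def exceedances_def)
qed

lemma mqs_scheduled_upd:
  "mqs_scheduled W \<tau> S i (x(i := (x i)(\<tau> := z))) \<longleftrightarrow>
    (\<forall>j \<in> S - {i}. exceedances W \<tau> (x i) z < exceedances W \<tau> (x j) (x j \<tau>))"
  unfolding mqs_scheduled_def
proof (intro ball_cong refl)
  fix j assume "j \<in> S - {i}"
  then have "(x(i := (x i)(\<tau> := z))) j = x j" by simp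
  then show "mqs_rank W ((x(i := (x i)(\<tau> := z))) i) \<tau> < mqs_rank W ((x(i := (x i)(\<tau> := z))) j) \<tau> \<longleftrightarrow>
      exceedances W \<tau> (x i) z < exceedances W \<tau> (x j) (x j \<tau>)"
    by (simp only: fun_upd_same mqs_rank_upd) (simp add: mqs_rank_eq)
qed

text \<open>Measurability is asked only of the past coordinates, so that the lemma also serves
  histories from which the current coordinate has been removed.\<close>

lemma measurable_exceedances[measurable (raw)]:
  assumes [measurable]: "\<And>h. h \<in> {1..<W} \<Longrightarrow> (\<lambda>x. g x (\<tau> - int h)) \<in> borel_measurable N"
    "f \<in> borel_measurable N"
  shows "(\<lambda>x. exceedances W \<tau> (g x) (f x)) \<in> measurable N (count_space UNIV)"
proof -
  have [measurable]: "{x \<in> space N. h \<in> {h \<in> {1..<W}. f x < g x (\<tau> - int h)}} \<in> sets N" for h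
    by (cases "h \<in> {1..<W}") auto
  show ?thesis unfolding exceedances_def by measurable
qed

section \<open>Law of the ranks, and the scheduling probability for a fixed set of users\<close>

context uplink_station
begin

lemma SINR_measurable[measurable]: "\<gamma> j t \<in> borel_measurable M"
  using distributed_measurable[OF SINR_distributed[of j t]] by simp

text \<open>\<open>distributed\<close> yields measurability of the \<open>ennreal\<close> version;
  nonnegativity of \<open>p\<close> allows going back through \<open>enn2real\<close>.\<close>

lemma density_measurable[measurable]: "p (loc j) \<in> borel_measurable borel"
proof -
  have "(\<lambda>x. enn2real (ennreal (p (loc j) x))) \<in> borel_measurable borel"
    using distributed_borel_measurable[OF SINR_distributed[of j 0]] by simp
  then show ?thesis using density_nonneg[OF loc_in] by simp
qed

lemma distr_SINR: "distr M borel (\<gamma> j t) = density lborel (\<lambda>x. ennreal (p (loc j) x))"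
  using distributed_distr_eq_density[OF SINR_distributed[of j t]]
  by (simp cong: distr_cong)

text \<open>The density vanishes on negative arguments, so the mass of \<open>{..z}\<close> is the
  integral over \<open>{0..z}\<close>. For negative \<open>z\<close> that interval is empty and both
  sides are 1.\<close>

lemma prob_SINR_greater:
  "prob (\<gamma> j t -` {z<..} \<inter> space M) = 1 - (LINT t:{0..z}|lborel. p (loc j) t)"
proof -
  have "emeasure M (\<gamma> j t -` {..z} \<inter> space M) = emeasure (distr M borel (\<gamma> j t)) {..z}"
    by (simp add: emeasure_distr)
  also have "\<dots> = (\<integral>\<^sup>+x. ennreal (p (loc j) x) * indicator {..z} x \<partial>lborel)"
    unfolding distr_SINR by (simp add: emeasure_density)
  also have "\<dots> = (\<integral>\<^sup>+x. ennreal (indicator {0..z} x * p (loc j) x) \<partial>lborel)"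
    using density_support[OF loc_in]
    by (intro nn_integral_cong) (auto simp: indicator_def not_le)
  finally have "prob (\<gamma> j t -` {..z} \<inter> space M) = (LINT t:{0..z}|lborel. p (loc j) t)"
    unfolding set_lebesgue_integral_def measure_def
    using density_nonneg[OF loc_in]
    by (subst integral_eq_nn_integral) auto
  moreover have "\<gamma> j t -` {z<..} \<inter> space M = space M - (\<gamma> j t -` {..z} \<inter> space M)"
    by auto
  ultimately show ?thesis by (simp add: prob_compl)
qed

lemma indep_SINR_window: "indep_vars (\<lambda>_. borel) (\<lambda>h. \<gamma> j (\<tau> - int h)) H"
  using indep_vars_reindex[OF SINR_indep, of "\<lambda>h. (j, \<tau> - int h)" H] by (simp add: inj_on_def)

text \<open>Binomial law with success probability \<open>1 - F\<close> over the \<open>W - 1\<close>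
  past blocks; \<open>m = n - 1\<close> will give \<open>Q_coeff\<close>.\<close>

lemma prob_exceedances:
  fixes j z defines "F \<equiv> LINT t:{0..z}|lborel. p (loc j) t"
  shows "prob {\<omega> \<in> space M. exceedances W \<tau> (\<lambda>t. \<gamma> j t \<omega>) z = m}
    = real ((W - 1) choose m) * (1 - F) ^ m * F ^ (W - 1 - m)"
  using prob_card_indep_events[OF indep_SINR_window[of j \<tau> "{1..<W}"] finite_atLeastLessThan,
      of "{z<..}" _ m, OF _ prob_SINR_greater]
  by (simp add: exceedances_def F_def)

lemma prob_rank_gt:
  assumes "1 \<le> W"
  shows "prob {\<omega> \<in> space M. n \<le> exceedances W \<tau> (\<lambda>t. \<gamma> j t \<omega>) (\<gamma> j \<tau> \<omega>)} = real (W - n) / real W"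
proof -
  \<comment> \<open>A law with a Lebesgue density has no atoms, which excludes ties inside the
    window.\<close>
  have "emeasure (density lborel (\<lambda>x. ennreal (p (loc j) x))) {x} = 0" for x
    by (simp add: emeasure_density nn_integral_0_iff_AE)
  then have "prob {\<omega> \<in> space M. n \<le> card {h \<in> {..<W}. \<gamma> j (\<tau> - int 0) \<omega> < \<gamma> j (\<tau> - int h) \<omega>}}
      = real (W - n) / real W"
    using iid_rank_uniform[OF indep_SINR_window, of "{..<W}" 0 j \<tau>] assms distr_SINR by simp
  \<comment> \<open>The uniform rank lemma includes the current value as \<open>h = 0\<close>; it
    never exceeds itself and drops out of the count.\<close>
  moreover have "{h \<in> {..<W}. \<gamma> j \<tau> \<omega> < \<gamma> j (\<tau> - int h) \<omega>}
      = {h \<in> {1..<W}. \<gamma> j \<tau> \<omega> < \<gamma> j (\<tau> - int h) \<omega>}" for \<omega>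
    by (auto simp: Suc_le_eq intro!: gr0I)
  ultimately show ?thesis by (simp add: exceedances_def)
qed

text \<open>The event is split by the rank \<open>n\<close> of user \<open>i\<close>. Each user's
  rank depends only on that user's own SINR values, so the probability of every piece factorizes
  over the users.\<close>

lemma prob_scheduled_frozen:
  assumes W: "1 \<le> W" and S: "finite S" "i \<in> S"
  shows "prob {\<omega> \<in> space M. mqs_scheduled W \<tau> S i ((\<lambda>j t. \<gamma> j t \<omega>)(i := (\<lambda>t. \<gamma> i t \<omega>)(\<tau> := z)))}
    = (\<Sum>n=1..W. Q_coeff (p (loc i)) W n z * (real (W - n) / real W) ^ (card S - 1))"
proof -
  define Z where "Z j \<omega> = exceedances W \<tau> (\<lambda>t. \<gamma> j t \<omega>) (if j = i then z else \<gamma> j \<tau> \<omega>)" for j \<omega>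
  have Z_meas[measurable]: "Z j \<in> measurable M (count_space UNIV)" for j
    unfolding Z_def by measurable
  \<comment> \<open>The SINR values of different users form disjoint blocks of one independent
    family; \<open>Z j\<close> is a function of block \<open>j\<close>.\<close>
  have "indep_vars (\<lambda>j. PiM ({j} \<times> UNIV) (\<lambda>_. borel))
      (\<lambda>j \<omega>. restrict (\<lambda>jt. (\<lambda>(j, t). \<gamma> j t) jt \<omega>) ({j} \<times> UNIV)) S"
    by (intro indep_vars_restrict[OF SINR_indep]) (auto simp: disjoint_family_on_def)
  then have "indep_vars (\<lambda>_. count_space UNIV)
      (\<lambda>j \<omega>. (\<lambda>x. exceedances W \<tau> (\<lambda>t. x (j, t)) (if j = i then z else x (j, \<tau>)))
        (restrict (\<lambda>jt. (\<lambda>(j, t). \<gamma> j t) jt \<omega>) ({j} \<times> UNIV))) S"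
    by (rule indep_vars_compose2) (auto intro!: measurable_exceedances measurable_component_singleton)
  then have indep: "indep_vars (\<lambda>_. count_space UNIV) Z S"
    by (simp add: Z_def[abs_def] cong: if_cong)
  \<comment> \<open>As \<open>Z\<close> is the rank minus one, rank exactly \<open>n\<close> for
    user \<open>i\<close> means \<open>n - 1\<close>, and rank above \<open>n\<close> for the others
    means at least \<open>n\<close>.\<close>
  let ?C = "\<lambda>n j. if j = i then {n - 1} else {n..}"
  let ?E = "\<lambda>n. \<Inter>j\<in>S. Z j -` ?C n j \<inter> space M"
  have "{\<omega> \<in> space M. mqs_scheduled W \<tau> S i ((\<lambda>j t. \<gamma> j t \<omega>)(i := (\<lambda>t. \<gamma> i t \<omega>)(\<tau> := z)))}
      = {\<omega> \<in> space M. \<forall>j\<in>S - {i}. Z i \<omega> < Z j \<omega>}"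
    using mqs_scheduled_upd[of W \<tau> S i "\<lambda>j t. \<gamma> j t _" z] by (auto simp: Z_def)
  also have "\<dots> = (\<Union>n\<in>{1..W}. ?E n)"
  proof -
    have "Z i \<omega> < W" for \<omega>
      using exceedances_le[of W \<tau> "\<lambda>t. \<gamma> i t \<omega>" z] W by (simp add: Z_def)
    then have into: "\<omega> \<in> ?E (Suc (Z i \<omega>)) \<and> Suc (Z i \<omega>) \<in> {1..W}"
      if "\<omega> \<in> space M" "\<forall>j\<in>S - {i}. Z i \<omega> < Z j \<omega>" for \<omega>
      using that S by (auto simp: Suc_le_eq)
    have outof: "\<forall>j\<in>S - {i}. Z i \<omega> < Z j \<omega>" if "n \<in> {1..W}" "\<omega> \<in> ?E n" for n \<omega>
    proof
      fix j assume "j \<in> S - {i}"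
      then have "\<omega> \<in> Z j -` ?C n j" "\<omega> \<in> Z i -` ?C n i" using that S by blast+
      then show "Z i \<omega> < Z j \<omega>" using that \<open>j \<in> S - {i}\<close> by auto
    qed
    show ?thesis
    proof (rule set_eqI, rule iffI)
      fix \<omega> assume "\<omega> \<in> {\<omega> \<in> space M. \<forall>j\<in>S - {i}. Z i \<omega> < Z j \<omega>}"
      then show "\<omega> \<in> (\<Union>n\<in>{1..W}. ?E n)"
        using into[of \<omega>] by (intro UN_I[of "Suc (Z i \<omega>)"]) simp_all
    next
      fix \<omega> assume "\<omega> \<in> (\<Union>n\<in>{1..W}. ?E n)"
      then obtain n where n: "n \<in> {1..W}" "\<omega> \<in> ?E n" by (rule UN_E)
      then have "\<omega> \<in> space M" using S(2) by blast
      then show "\<omega> \<in> {\<omega> \<in> space M. \<forall>j\<in>S - {i}. Z i \<omega> < Z j \<omega>}"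
        using outof[OF n] by simp
    qed
  qed
  also have "prob \<dots> = (\<Sum>n=1..W. prob (?E n))"
  proof (rule finite_measure_finite_Union)
    show "?E ` {1..W} \<subseteq> events"
    proof (intro image_subsetI sets.finite_INT)
      show "Z j -` ?C n j \<inter> space M \<in> events" for n j
        by (intro measurable_sets[OF Z_meas]) simp
    qed (use S in auto)
    show "disjoint_family_on ?E {1..W}"
    proof (unfold disjoint_family_on_def, intro ballI impI)
      fix m n :: nat assume mn: "m \<in> {1..W}" "n \<in> {1..W}" "m \<noteq> n"
      have "?E k \<subseteq> Z i -` {k - 1}" for k using INT_lower[OF S(2), of "\<lambda>j. Z j -` ?C k j \<inter> space M"] by simp
      then have "?E m \<inter> ?E n \<subseteq> Z i -` {m - 1} \<inter> Z i -` {n - 1}" by blast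
      \<comment> \<open>Subtraction truncates at 0; \<open>m\<close> and \<open>n\<close> being at
        least 1 makes \<open>m - 1\<close> and \<open>n - 1\<close> differ.\<close>
      also have "\<dots> = {}" using mn by auto
      finally show "?E m \<inter> ?E n = {}" by blast
    qed
  qed auto
  also have "\<dots> = (\<Sum>n=1..W. Q_coeff (p (loc i)) W n z * (real (W - n) / real W) ^ (card S - 1))"
  proof (rule sum.cong[OF refl])
    fix n assume n: "n \<in> {1..W}"
    have "prob (?E n) = (\<Prod>j\<in>S. prob (Z j -` ?C n j \<inter> space M))"
      using S by (intro indep_varsD_finite[OF indep]) auto
    also have "\<dots> = prob (Z i -` {n - 1} \<inter> space M) * (\<Prod>j\<in>S - {i}. prob (Z j -` {n..} \<inter> space M))"
      using S by (subst prod.remove[of S i]) (auto intro!: prod.cong)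
    also have "prob (Z i -` {n - 1} \<inter> space M) = Q_coeff (p (loc i)) W n z"
      using prob_exceedances[of W \<tau> i z "n - 1"] n W
      by (simp add: Q_coeff_def Z_def vimage_def Int_def conj_commute[of _ "_ \<in> space M"])
    also have "(\<Prod>j\<in>S - {i}. prob (Z j -` {n..} \<inter> space M)) = (\<Prod>j\<in>S - {i}. real (W - n) / real W)"
    proof (intro prod.cong refl)
      fix j assume "j \<in> S - {i}"
      then show "prob (Z j -` {n..} \<inter> space M) = real (W - n) / real W"
        using prob_rank_gt[OF W, of n \<tau> j] by (simp add: Z_def vimage_def Int_def conj_commute[of _ "_ \<in> space M"])
    qed
    finally show "prob (?E n) = Q_coeff (p (loc i)) W n z * (real (W - n) / real W) ^ (card S - 1)"
      using S by simp
  qed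
  finally show ?thesis .
qed

section \<open>Conditioning on the number of users and on the SINR\<close>

text \<open>The whole SINR field as one random element of a product space: events about it become
  preimages, the form in which independence from \<open>U\<close> is assumed.\<close>

definition sinr :: "'w \<Rightarrow> 'user \<times> int \<Rightarrow> real" where
  "sinr \<omega> = (\<lambda>(j, t). \<gamma> j t \<omega>)"

abbreviation Sinr :: "('user \<times> int \<Rightarrow> real) measure" where
  "Sinr \<equiv> Pi\<^sub>M UNIV (\<lambda>_. borel)"

lemma sinr_apply[simp]: "sinr \<omega> (j, t) = \<gamma> j t \<omega>"
  by (simp add: sinr_def)

lemma sinr_measurable[measurable]: "sinr \<in> measurable M Sinr"
  by (rule measurable_PiM_single') (auto simp: sinr_def split_beta)

lemma U_eq_events[measurable]: "{\<omega> \<in> space M. U \<omega> = u} \<in> events"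
  using U_measurable by measurable

lemma prob_U_sinr:
  assumes B: "B \<in> sets Sinr"
  shows "prob ({\<omega> \<in> space M. U \<omega> = u} \<inter> (sinr -` B \<inter> space M))
    = prob {\<omega> \<in> space M. U \<omega> = u} * prob (sinr -` B \<inter> space M)"
proof (rule indep_setD[OF U_indep_SINR])
  have "{\<omega> \<in> space M. U \<omega> = u} = U -` {u} \<inter> space M" by auto
  then show "{\<omega> \<in> space M. U \<omega> = u} \<in> sets (vimage_algebra (space M) U (count_space UNIV))"
    by (metis UNIV_I in_vimage_algebra sets_count_space Pow_UNIV)
  show "sinr -` B \<inter> space M \<in> sets (vimage_algebra (space M) (\<lambda>\<omega> (j, t). \<gamma> j t \<omega>) Sinr)"
    using in_vimage_algebra[OF B, of sinr "space M"] by (simp add: sinr_def[abs_def])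
qed

text \<open>Independence cancels the factor
  \<open>prob {\<omega> \<in> space M. U \<omega> = u}\<close>. This equality of laws is the bridge
  by which integrals and almost sure statements move between \<open>M\<close> and the conditioned
  measure.\<close>

lemma distr_sinr_given_U:
  assumes u: "prob {\<omega> \<in> space M. U \<omega> = u} \<noteq> 0"
  shows "distr (uniform_measure M {\<omega> \<in> space M. U \<omega> = u}) Sinr sinr = distr M Sinr sinr"
proof (rule measure_eqI)
  let ?N = "uniform_measure M {\<omega> \<in> space M. U \<omega> = u}"
  have e: "emeasure M {\<omega> \<in> space M. U \<omega> = u} \<noteq> 0"
    using u by (simp add: emeasure_eq_measure)
  interpret N: prob_space ?N
    using e by (intro prob_space_uniform_measure) auto
  fix B assume "B \<in> sets (distr ?N Sinr sinr)"
  then have B: "B \<in> sets Sinr" by simp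
  have [measurable]: "sinr \<in> measurable ?N Sinr" by simp
  have "emeasure (distr ?N Sinr sinr) B = emeasure ?N (sinr -` B \<inter> space M)"
    using B by (subst emeasure_distr) auto
  also have "\<dots> = ennreal (prob ({\<omega> \<in> space M. U \<omega> = u} \<inter> (sinr -` B \<inter> space M))
      / prob {\<omega> \<in> space M. U \<omega> = u})"
    using B e measurable_sets[OF sinr_measurable B]
    by (subst N.emeasure_eq_measure) (simp add: emeasure_eq_measure[symmetric])
  also have "\<dots> = emeasure (distr M Sinr sinr) B"
    using B u by (simp add: prob_U_sinr emeasure_distr emeasure_eq_measure)
  finally show "emeasure (distr ?N Sinr sinr) B = emeasure (distr M Sinr sinr) B" .
qed simp

text \<open>The coordinate \<open>(i, \<tau>)\<close> of \<open>g\<close> is exempt from the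
  measurability condition because the update overwrites it by \<open>f\<close>. This permits
  families in which that coordinate is missing.\<close>

lemma measurable_mqs_scheduled_upd:
  assumes S: "finite S" and g: "\<And>j t. (j, t) \<noteq> (i, \<tau>) \<Longrightarrow> (\<lambda>x. g x j t) \<in> borel_measurable N"
    and f[measurable]: "f \<in> borel_measurable N"
  shows "{x \<in> space N. mqs_scheduled W \<tau> S i ((g x)(i := (g x i)(\<tau> := f x)))} \<in> sets N"
proof -
  note [measurable] = g
  have [measurable]: "(\<lambda>x. exceedances W \<tau> (g x i) (f x)) \<in> borel_measurable N"
    by (rule measurable_compose[where g = "\<lambda>n. n" and N = "count_space UNIV"], intro measurable_exceedances)
      auto
  have "{x \<in> space N. exceedances W \<tau> (g x i) (f x) < exceedances W \<tau> (g x j) (g x j \<tau>)} \<in> sets N"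
    if "j \<in> S - {i}" for j
  proof -
    have [measurable]: "(\<lambda>x. exceedances W \<tau> (g x j) (g x j \<tau>)) \<in> borel_measurable N"
      by (rule measurable_compose[where g = "\<lambda>n. n" and N = "count_space UNIV"], intro measurable_exceedances g)
        (use that in auto)
    show ?thesis by measurable
  qed
  then show ?thesis
    unfolding mqs_scheduled_upd using S by (intro sets.sets_Collect_finite_All) auto
qed

lemma sched_prob_eq:
  assumes u: "prob {\<omega> \<in> space M. U \<omega> = u} \<noteq> 0" and S: "finite (served u)"
  shows "sched_prob M \<gamma> U served W \<tau> i u z = prob {\<omega> \<in> space M.
    mqs_scheduled W \<tau> (served u) i ((\<lambda>j t. \<gamma> j t \<omega>)(i := (\<lambda>t. \<gamma> i t \<omega>)(\<tau> := z)))}"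
proof -
  define B where "B = {x \<in> space Sinr.
    mqs_scheduled W \<tau> (served u) i ((\<lambda>j t. x (j, t))(i := (\<lambda>t. x (i, t))(\<tau> := z)))}"
  have B: "B \<in> sets Sinr"
    unfolding B_def using measurable_mqs_scheduled_upd[OF S, of i \<tau> "\<lambda>x j t. x (j, t)" Sinr "\<lambda>_. z" W] by simp
  have pre: "sinr -` B \<inter> space M = {\<omega> \<in> space M.
    mqs_scheduled W \<tau> (served u) i ((\<lambda>j t. \<gamma> j t \<omega>)(i := (\<lambda>t. \<gamma> i t \<omega>)(\<tau> := z)))}"
    by (auto simp: B_def space_PiM)
  have "prob {\<omega> \<in> space M. mqs_scheduled W \<tau> (served u) i
      ((\<lambda>j t. \<gamma> j t \<omega>)(i := (\<lambda>t. \<gamma> i t \<omega>)(\<tau> := z))) \<and> U \<omega> = u}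
      = prob ({\<omega> \<in> space M. U \<omega> = u} \<inter> (sinr -` B \<inter> space M))"
    unfolding pre by (rule arg_cong[where f = prob]) auto
  then show ?thesis
    using u by (simp add: sched_prob_def cond_prob_def prob_U_sinr[OF B, unfolded pre] pre)
qed

text \<open>The field is split into the single coordinate \<open>(i, \<tau>)\<close> and all the
  others, which are independent; Fubini then freezes the former while the latter are
  averaged.\<close>

lemma expectation_scheduled_frozen:
  assumes S: "finite S" and B: "B \<in> sets borel"
  shows "expectation (\<lambda>\<omega>. indicator B (\<gamma> i \<tau> \<omega>) *
      indicator {\<omega> \<in> space M. mqs_scheduled W \<tau> S i (\<lambda>j t. \<gamma> j t \<omega>)} \<omega> :: real)
    = expectation (\<lambda>\<omega>. indicator B (\<gamma> i \<tau> \<omega>) * prob {\<omega>' \<in> space M.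
        mqs_scheduled W \<tau> S i ((\<lambda>j t. \<gamma> j t \<omega>')(i := (\<lambda>t. \<gamma> i t \<omega>')(\<tau> := \<gamma> i \<tau> \<omega>)))})"
proof -
  let ?I = "{(i, \<tau>)}" and ?J = "UNIV - {(i, \<tau>)}"
  let ?S = "Pi\<^sub>M ?I (\<lambda>_. borel :: real measure)" and ?T = "Pi\<^sub>M ?J (\<lambda>_. borel :: real measure)"
  let ?X = "\<lambda>\<omega>. restrict (sinr \<omega>) ?I" and ?Y = "\<lambda>\<omega>. restrict (sinr \<omega>) ?J"
  let ?sched = "\<lambda>x z. mqs_scheduled W \<tau> S i (x(i := (x i)(\<tau> := z)))"
  \<comment> \<open>\<open>snd xy\<close> carries no information at \<open>(i, \<tau>)\<close>; the
    update inside \<open>?sched\<close> supplies that value from \<open>fst xy\<close>.\<close>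
  define C where "C = {xy \<in> space (?S \<Otimes>\<^sub>M ?T). ?sched (\<lambda>j t. snd xy (j, t)) (fst xy (i, \<tau>))}"
  define f where "f xy = indicator B (fst xy (i, \<tau>)) * (indicator C xy :: real)" for xy
  have indep: "indep_var ?S ?X ?T ?Y"
    using indep_var_restrict[OF SINR_indep, of ?I ?J] by (simp add: sinr_def split_beta')
  note rv[measurable] = indep_var_rv1[OF indep] indep_var_rv2[OF indep]
  have C[measurable]: "C \<in> sets (?S \<Otimes>\<^sub>M ?T)"
    unfolding C_def
  proof (rule measurable_mqs_scheduled_upd[OF S, of i \<tau> "\<lambda>xy j t. snd xy (j, t)"])
    show "(\<lambda>xy. snd xy (j, t)) \<in> borel_measurable (?S \<Otimes>\<^sub>M ?T)" if "(j, t) \<noteq> (i, \<tau>)" for j t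
      using that by (intro measurable_compose[OF measurable_snd measurable_component_singleton]) auto
    show "(\<lambda>xy. fst xy (i, \<tau>)) \<in> borel_measurable (?S \<Otimes>\<^sub>M ?T)"
      by (intro measurable_compose[OF measurable_fst measurable_component_singleton]) auto
  qed
  have comp: "(\<lambda>xy. fst xy (i, \<tau>)) \<in> borel_measurable (?S \<Otimes>\<^sub>M ?T)"
    by (intro measurable_compose[OF measurable_fst measurable_component_singleton]) auto
  have f[measurable]: "f \<in> borel_measurable (?S \<Otimes>\<^sub>M ?T)"
    unfolding f_def using B comp by measurable
  have fXY: "f (?X \<omega>, ?Y \<omega>') = indicator B (\<gamma> i \<tau> \<omega>) *
      indicator {\<omega>' \<in> space M. ?sched (\<lambda>j t. \<gamma> j t \<omega>') (\<gamma> i \<tau> \<omega>)} \<omega>'"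
    if "\<omega> \<in> space M" "\<omega>' \<in> space M" for \<omega> \<omega>'
  proof -
    have space: "(?X \<omega>, ?Y \<omega>') \<in> space (?S \<Otimes>\<^sub>M ?T)"
      by (auto simp: space_pair_measure space_PiM)
    have X: "?X \<omega> (i, \<tau>) = \<gamma> i \<tau> \<omega>" by simp
    have "exceedances W \<tau> (\<lambda>t. ?Y \<omega>' (i, t)) z = exceedances W \<tau> (\<lambda>t. \<gamma> i t \<omega>') z" for z
      unfolding exceedances_def by (rule arg_cong[where f = card]) auto
    moreover have "exceedances W \<tau> (\<lambda>t. ?Y \<omega>' (j, t)) (?Y \<omega>' (j, \<tau>))
        = exceedances W \<tau> (\<lambda>t. \<gamma> j t \<omega>') (\<gamma> j \<tau> \<omega>')" if "j \<in> S - {i}" for j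
      using that by simp
    ultimately have "?sched (\<lambda>j t. ?Y \<omega>' (j, t)) z \<longleftrightarrow> ?sched (\<lambda>j t. \<gamma> j t \<omega>') z" for z
      unfolding mqs_scheduled_upd[of W \<tau> S i "\<lambda>j t. ?Y \<omega>' (j, t)" z]
        mqs_scheduled_upd[of W \<tau> S i "\<lambda>j t. \<gamma> j t \<omega>'" z]
      by (intro ball_cong refl) (simp only:)
    then have "(?X \<omega>, ?Y \<omega>') \<in> C \<longleftrightarrow> ?sched (\<lambda>j t. \<gamma> j t \<omega>') (\<gamma> i \<tau> \<omega>)"
      by (simp only: C_def mem_Collect_eq fst_conv snd_conv space X simp_thms)
    then show ?thesis
      using that by (auto simp: f_def indicator_def)
  qed
  have int: "integrable M (\<lambda>\<omega>. f (?X \<omega>, ?Y \<omega>))"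
  proof (rule integrable_const_bound[where B = 1])
    show "(\<lambda>\<omega>. f (?X \<omega>, ?Y \<omega>)) \<in> borel_measurable M"
      by (rule measurable_compose[OF measurable_Pair[OF rv] f])
  qed (auto simp: f_def indicator_def)
  \<comment> \<open>Freezing the coordinate at its actual value is no change, so on the diagonal
    \<open>f\<close> describes the genuine scheduling event.\<close>
  have upd: "?sched (\<lambda>j t. \<gamma> j t \<omega>) (\<gamma> i \<tau> \<omega>) \<longleftrightarrow> mqs_scheduled W \<tau> S i (\<lambda>j t. \<gamma> j t \<omega>)" for \<omega>
    by (rule arg_cong[where f = "mqs_scheduled W \<tau> S i"]) (simp add: fun_eq_iff)
  have "expectation (\<lambda>\<omega>. indicator B (\<gamma> i \<tau> \<omega>) *
      indicator {\<omega> \<in> space M. mqs_scheduled W \<tau> S i (\<lambda>j t. \<gamma> j t \<omega>)} \<omega> :: real)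
      = expectation (\<lambda>\<omega>. f (?X \<omega>, ?Y \<omega>))"
    by (intro Bochner_Integration.integral_cong refl) (simp add: fXY upd indicator_def)
  also have "\<dots> = expectation (\<lambda>\<omega>. expectation (\<lambda>\<omega>'. f (?X \<omega>, ?Y \<omega>')))"
    by (rule indep_var_expectation_freeze[OF indep f int])
  also have "\<dots> = expectation (\<lambda>\<omega>. indicator B (\<gamma> i \<tau> \<omega>) *
      prob {\<omega>' \<in> space M. ?sched (\<lambda>j t. \<gamma> j t \<omega>') (\<gamma> i \<tau> \<omega>)})"
  proof (intro Bochner_Integration.integral_cong refl)
    fix \<omega> assume \<omega>: "\<omega> \<in> space M"
    have "expectation (\<lambda>\<omega>'. f (?X \<omega>, ?Y \<omega>')) = expectation (\<lambda>\<omega>'. indicator B (\<gamma> i \<tau> \<omega>) *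
      indicator {\<omega>' \<in> space M. ?sched (\<lambda>j t. \<gamma> j t \<omega>') (\<gamma> i \<tau> \<omega>)} \<omega>')"
      using \<omega> by (intro Bochner_Integration.integral_cong refl) (simp add: fXY)
    also have "\<dots> = indicator B (\<gamma> i \<tau> \<omega>) *
        prob ({\<omega>' \<in> space M. ?sched (\<lambda>j t. \<gamma> j t \<omega>') (\<gamma> i \<tau> \<omega>)} \<inter> space M)"
      by simp
    finally show "expectation (\<lambda>\<omega>'. f (?X \<omega>, ?Y \<omega>')) = indicator B (\<gamma> i \<tau> \<omega>) *
        prob {\<omega>' \<in> space M. ?sched (\<lambda>j t. \<gamma> j t \<omega>') (\<gamma> i \<tau> \<omega>)}"
      by (simp add: Int_absorb2)
  qed
  finally show ?thesis .
qed

text \<open>A distribution function is monotone, hence Borel; monotonicity comes from the shrinking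
  rays \<open>{z<..}\<close>.\<close>

lemma SINR_cdf_measurable[measurable]: "(\<lambda>z. LINT t:{0..z}|lborel. p (loc j) t) \<in> borel_measurable borel"
proof -
  have "(\<lambda>z. 1 - measure (distr M borel (\<gamma> j 0)) {z<..}) \<in> borel_measurable borel"
  proof (rule borel_measurable_mono)
    interpret D: prob_space "distr M borel (\<gamma> j 0)"
      by (rule prob_space_distr) simp
    show "mono (\<lambda>z. 1 - measure (distr M borel (\<gamma> j 0)) {z<..})"
      by (intro monoI diff_mono order_refl D.finite_measure_mono) auto
  qed
  then show ?thesis by (simp add: measure_distr prob_SINR_greater)
qed

lemma prob_scheduled_frozen_measurable[measurable]:
  assumes "1 \<le> W" "finite S" "i \<in> S"
  shows "(\<lambda>z. prob {\<omega> \<in> space M. mqs_scheduled W \<tau> S i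
    ((\<lambda>j t. \<gamma> j t \<omega>)(i := (\<lambda>t. \<gamma> i t \<omega>)(\<tau> := z)))}) \<in> borel_measurable borel"
  unfolding prob_scheduled_frozen[OF assms] Q_coeff_def by measurable

lemma sched_prob_null:
  assumes "prob {\<omega> \<in> space M. U \<omega> = u} = 0"
  shows "sched_prob M \<gamma> U served W \<tau> i u z = 0"
  using assms by (simp add: sched_prob_def cond_prob_def)

text \<open>The conditional expectation is characterized by its integrals over the sets
  \<open>{\<gamma> i \<tau> \<in> B}\<close>. These integrals are carried from the conditioned
  measure to \<open>M\<close>, evaluated there by freezing, and carried back.\<close>

lemma is_cond_prob_sched_prob:
  assumes W: "1 \<le> W" and S: "finite (served u)" "i \<in> served u"
  shows "is_cond_prob_given (uniform_measure M {\<omega> \<in> space M. U \<omega> = u}) (\<gamma> i \<tau>)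
    {\<omega> \<in> space M. mqs_scheduled W \<tau> (served u) i (\<lambda>j t. \<gamma> j t \<omega>)}
    (sched_prob M \<gamma> U served W \<tau> i u)"
proof (cases "prob {\<omega> \<in> space M. U \<omega> = u} = 0")
  case True
  then have null: "AE \<omega> in M. U \<omega> \<noteq> u"
    by (subst AE_iff_measurable[where N = "{\<omega> \<in> space M. U \<omega> = u}"]) (auto simp: emeasure_eq_measure)
  \<comment> \<open>Conditioning on a null event gives the null measure, under which every property
    holds almost everywhere; only measurability is left.\<close>
  have "AE \<omega> in uniform_measure M {\<omega> \<in> space M. U \<omega> = u}. P \<omega>" for P
    by (rule AE_uniform_measureI, simp, rule AE_mp[OF null]) simp
  moreover have "sched_prob M \<gamma> U served W \<tau> i u = (\<lambda>_. 0)"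
    using sched_prob_null[OF True] by (simp add: fun_eq_iff)
  ultimately show ?thesis
    by (simp add: is_cond_prob_given_def)
next
  case False
  let ?N = "uniform_measure M {\<omega> \<in> space M. U \<omega> = u}"
  let ?F = "vimage_algebra (space ?N) (\<gamma> i \<tau>) borel"
  define E where "E = {\<omega> \<in> space M. mqs_scheduled W \<tau> (served u) i (\<lambda>j t. \<gamma> j t \<omega>)}"
  define c where "c = sched_prob M \<gamma> U served W \<tau> i u"
  \<comment> \<open>The update by \<open>x (i, \<tau>)\<close> itself is vacuous; it brings the
    event into the shape of \<open>measurable_mqs_scheduled_upd\<close>.\<close>
  define T where "T = {x \<in> space Sinr. mqs_scheduled W \<tau> (served u) i
    ((\<lambda>j t. x (j, t))(i := (\<lambda>t. x (i, t))(\<tau> := x (i, \<tau>))))}"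
  have c_eq: "c z = prob {\<omega> \<in> space M. mqs_scheduled W \<tau> (served u) i
      ((\<lambda>j t. \<gamma> j t \<omega>)(i := (\<lambda>t. \<gamma> i t \<omega>)(\<tau> := z)))}" for z
    unfolding c_def by (rule sched_prob_eq[OF False S(1)])
  have c_meas[measurable]: "c \<in> borel_measurable borel"
    using prob_scheduled_frozen_measurable[OF W S] by (simp add: c_eq[abs_def])
  have c_bound: "norm (c z) \<le> 1" for z
    by (simp add: c_eq)
  have T[measurable]: "T \<in> sets Sinr"
    unfolding T_def
    using measurable_mqs_scheduled_upd[OF S(1), of i \<tau> "\<lambda>x j t. x (j, t)" Sinr "\<lambda>x. x (i, \<tau>)" W] by simp
  have "(\<lambda>j t. \<gamma> j t \<omega>)(i := (\<lambda>t. \<gamma> i t \<omega>)(\<tau> := \<gamma> i \<tau> \<omega>)) = (\<lambda>j t. \<gamma> j t \<omega>)" for \<omega>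
    by (simp add: fun_eq_iff)
  then have E: "E = sinr -` T \<inter> space M"
    by (auto simp: E_def T_def space_PiM)
  have E_meas[measurable]: "E \<in> events"
    unfolding E by measurable
  interpret N: prob_space ?N
    using False by (intro prob_space_uniform_measure) (auto simp: emeasure_eq_measure)
  have X[measurable]: "\<gamma> i \<tau> \<in> borel_measurable ?N" by simp
  have sub: "subalgebra ?N ?F"
    unfolding subalgebra_def using measurable_sets[OF SINR_measurable[of i \<tau>]]
    by (auto simp: sets_vimage_algebra2)
  interpret F: finite_measure_subalgebra ?N ?F
    by unfold_locales (rule sub)
  have sinr_N: "sinr \<in> measurable ?N Sinr" by simp
  have transfer: "(LINT \<omega>|?N. f (sinr \<omega>)) = expectation (\<lambda>\<omega>. f (sinr \<omega>))"
    if f: "f \<in> borel_measurable Sinr" for f :: "_ \<Rightarrow> real"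
    using integral_distr[OF sinr_N f] integral_distr[OF sinr_measurable f]
    by (simp add: distr_sinr_given_U[OF False])
  have "AE \<omega> in ?N. real_cond_exp ?N ?F (indicator E) \<omega> = c (\<gamma> i \<tau> \<omega>)"
  proof (rule F.real_cond_exp_charact)
    fix A assume "A \<in> sets ?F"
    then obtain B where B[measurable]: "B \<in> sets borel" and A: "A = \<gamma> i \<tau> -` B \<inter> space M"
      by (auto simp: sets_vimage_algebra2)
    have ind: "indicator A \<omega> = (indicator B (\<gamma> i \<tau> \<omega>) :: real)" "indicator E \<omega> = (indicator T (sinr \<omega>) :: real)"
      if "\<omega> \<in> space M" for \<omega>
      using that by (auto simp: A E indicator_def)
    have "(LINT \<omega>:A|?N. indicator E \<omega>)
        = (LINT \<omega>|?N. indicator B (sinr \<omega> (i, \<tau>)) * (indicator T (sinr \<omega>) :: real))"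
      unfolding set_lebesgue_integral_def by (intro Bochner_Integration.integral_cong) (auto simp: ind)
    also have "\<dots> = expectation (\<lambda>\<omega>. indicator B (sinr \<omega> (i, \<tau>)) * indicator T (sinr \<omega>))"
      by (rule transfer) measurable
    also have "\<dots> = expectation (\<lambda>\<omega>. indicator B (\<gamma> i \<tau> \<omega>) * indicator E \<omega>)"
      by (intro Bochner_Integration.integral_cong) (auto simp: ind)
    also have "\<dots> = expectation (\<lambda>\<omega>. indicator B (\<gamma> i \<tau> \<omega>) * c (\<gamma> i \<tau> \<omega>))"
      unfolding E_def c_eq by (rule expectation_scheduled_frozen[OF S(1) B])
    also have "\<dots> = expectation (\<lambda>\<omega>. indicator B (sinr \<omega> (i, \<tau>)) * c (sinr \<omega> (i, \<tau>)))"
      by simp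
    also have "\<dots> = (LINT \<omega>|?N. indicator B (sinr \<omega> (i, \<tau>)) * c (sinr \<omega> (i, \<tau>)))"
      by (rule transfer[symmetric]) measurable
    also have "\<dots> = (LINT \<omega>:A|?N. c (\<gamma> i \<tau> \<omega>))"
      unfolding set_lebesgue_integral_def by (intro Bochner_Integration.integral_cong) (auto simp: ind)
    finally show "(LINT \<omega>:A|?N. indicator E \<omega>) = (LINT \<omega>:A|?N. c (\<gamma> i \<tau> \<omega>))" .
  next
    show "integrable ?N (indicator E :: _ \<Rightarrow> real)"
      by (rule N.integrable_const_bound[where B = 1]) (auto simp: indicator_def)
    show "integrable ?N (\<lambda>\<omega>. c (\<gamma> i \<tau> \<omega>))"
      using c_bound by (intro N.integrable_const_bound[where B = 1]) auto
    show "(\<lambda>\<omega>. c (\<gamma> i \<tau> \<omega>)) \<in> borel_measurable ?F"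
      by (rule measurable_compose[OF measurable_vimage_algebra1 c_meas]) simp
  qed
  then have "AE \<omega> in ?N. c (\<gamma> i \<tau> \<omega>) = real_cond_exp ?N ?F (indicator E) \<omega>"
    by eventually_elim simp
  then show ?thesis
    using c_meas unfolding is_cond_prob_given_def E_def c_def by blast
qed

text \<open>Both versions agree almost surely at \<open>\<gamma> i \<tau>\<close>, hence almost
  everywhere for the law with density \<open>p (loc i)\<close>. Where this density vanishes, the
  factor \<open>p (loc i) z\<close> makes both sides 0.\<close>

lemma cond_prob_version_unique:
  assumes u: "prob {\<omega> \<in> space M. U \<omega> = u} \<noteq> 0"
    and c: "is_cond_prob_given (uniform_measure M {\<omega> \<in> space M. U \<omega> = u}) (\<gamma> i \<tau>) E c"
    and d: "is_cond_prob_given (uniform_measure M {\<omega> \<in> space M. U \<omega> = u}) (\<gamma> i \<tau>) E d"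
  shows "AE z in lborel. c z * p (loc i) z = d z * p (loc i) z"
proof -
  let ?N = "uniform_measure M {\<omega> \<in> space M. U \<omega> = u}"
  have [measurable]: "c \<in> borel_measurable borel" "d \<in> borel_measurable borel"
    using c d by (auto simp: is_cond_prob_given_def)
  have "AE \<omega> in ?N. c (\<gamma> i \<tau> \<omega>) = real_cond_exp ?N (vimage_algebra (space ?N) (\<gamma> i \<tau>) borel) (indicator E) \<omega>"
    "AE \<omega> in ?N. d (\<gamma> i \<tau> \<omega>) = real_cond_exp ?N (vimage_algebra (space ?N) (\<gamma> i \<tau>) borel) (indicator E) \<omega>"
    using c d by (auto simp: is_cond_prob_given_def)
  \<comment> \<open>Written through \<open>sinr\<close> so that the equality of the joint laws
    applies.\<close>
  then have "AE \<omega> in ?N. c (sinr \<omega> (i, \<tau>)) = d (sinr \<omega> (i, \<tau>))"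
    by eventually_elim simp
  then have "AE x in distr ?N Sinr sinr. c (x (i, \<tau>)) = d (x (i, \<tau>))"
    by (subst AE_distr_iff) auto
  then have "AE \<omega> in M. c (\<gamma> i \<tau> \<omega>) = d (\<gamma> i \<tau> \<omega>)"
    unfolding distr_sinr_given_U[OF u] by (subst (asm) AE_distr_iff) auto
  then have "AE z in distr M borel (\<gamma> i \<tau>). c z = d z"
    by (subst AE_distr_iff) auto
  then have "AE z in lborel. 0 < ennreal (p (loc i) z) \<longrightarrow> c z = d z"
    unfolding distr_SINR by (subst (asm) AE_density) auto
  then show ?thesis
  proof eventually_elim
    case (elim z)
    then show ?case using density_nonneg[OF loc_in, of i z] by (cases "p (loc i) z = 0") auto
  qed
qed

section \<open>Averaging over the number of users\<close>

text \<open>The finite sum over ranks is exchanged with the series over \<open>u\<close>, whose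
  values are \<open>T_coeff\<close>. The condition on \<open>c\<close> concerns one point
  \<open>z\<close>, so the lemma serves both the pointwise and the almost everywhere claim.\<close>

lemma scheduled_density_eq:
  assumes \<rho>: "0 \<le> \<rho>" "\<rho> < 1" and W: "1 \<le> W" and user: "\<And>u. 1 \<le> u \<Longrightarrow> i \<in> served u"
    and c: "\<And>u. 1 \<le> u \<Longrightarrow> prob {\<omega> \<in> space M. U \<omega> = u} \<noteq> 0 \<Longrightarrow>
      c u z * p (loc i) z = sched_prob M \<gamma> U served W \<tau> i u z * p (loc i) z"
  shows "scheduled_density M U c (p (loc i)) z
    = p (loc i) z * (\<Sum>n=1..W. Q_coeff (p (loc i)) W n z * T_coeff \<rho> W n)"
proof -
  let ?t = "\<lambda>n u. (1 - \<rho>) * \<rho> ^ (u - 1) * (real u * (real (W - n) / real W) ^ (u - 1))"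
  let ?Q = "\<lambda>n. Q_coeff (p (loc i)) W n z"
  have summand: "\<P>(\<omega> in M. U \<omega> = u \<bar> 1 \<le> U \<omega>) * scheduled_density_given c (p (loc i)) u z
      = p (loc i) z * (\<Sum>n=1..W. ?Q n * ?t n u)" if u: "1 \<le> u" for u
  proof (cases "prob {\<omega> \<in> space M. U \<omega> = u} = 0")
    \<comment> \<open>This occurs only for \<open>\<rho> = 0\<close> and \<open>u \<ge> 2\<close>;
      the geometric weight is then 0 as well, so both sides vanish whatever \<open>c u z\<close>
      is.\<close>
    case True
    have "{\<omega> \<in> space M. U \<omega> = u \<and> 1 \<le> U \<omega>} = {\<omega> \<in> space M. U \<omega> = u}"
      using u by auto
    then have "\<P>(\<omega> in M. U \<omega> = u \<bar> 1 \<le> U \<omega>) = 0"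
      using True by (simp add: cond_prob_def)
    moreover from this have "(1 - \<rho>) * \<rho> ^ (u - 1) = 0"
      using U_law[OF u] by simp
    ultimately show ?thesis
      by (simp only: mult_zero_left mult_zero_right sum.neutral_const)
  next
    case False
    have S: "finite (served u)" "card (served u) = u" using served_card[OF u] by auto
    have "c u z * p (loc i) z
        = (\<Sum>n=1..W. ?Q n * (real (W - n) / real W) ^ (u - 1)) * p (loc i) z"
      unfolding c[OF u False] sched_prob_eq[OF False S(1)]
        prob_scheduled_frozen[OF W S(1) user[OF u]] S(2) ..
    moreover have "scheduled_density_given c (p (loc i)) u z = real u * (c u z * p (loc i) z)"
      by (simp add: scheduled_density_given_def)
    ultimately have "\<P>(\<omega> in M. U \<omega> = u \<bar> 1 \<le> U \<omega>) * scheduled_density_given c (p (loc i)) u z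
      = (1 - \<rho>) * \<rho> ^ (u - 1) * (real u *
         ((\<Sum>n=1..W. ?Q n * (real (W - n) / real W) ^ (u - 1)) * p (loc i) z))"
      by (simp only: U_law[OF u])
    also have "\<dots> = p (loc i) z * (\<Sum>n=1..W. ?Q n * ?t n u)"
      by (simp only: sum_distrib_left sum_distrib_right mult_ac)
    finally show ?thesis .
  qed
  have "((\<lambda>u. p (loc i) z * (\<Sum>n=1..W. ?Q n * ?t n u))
      has_sum p (loc i) z * (\<Sum>n=1..W. ?Q n * T_coeff \<rho> W n)) {1..}"
    using \<rho> by (intro has_sum_cmult_right has_sum_sum T_coeff_has_sum) auto
  then have "((\<lambda>u. \<P>(\<omega> in M. U \<omega> = u \<bar> 1 \<le> U \<omega>) * scheduled_density_given c (p (loc i)) u z)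
      has_sum p (loc i) z * (\<Sum>n=1..W. ?Q n * T_coeff \<rho> W n)) {1..}"
    by (rule has_sum_cong[THEN iffD2, rotated]) (rule summand, simp)
  then show ?thesis
    unfolding scheduled_density_def by (rule infsumI)
qed

end

theorem theorem1:
  fixes M :: "'w measure"
    and A :: "'loc set"
    and p :: "'loc \<Rightarrow> real \<Rightarrow> real"
    and \<rho> :: real
    and loc :: "'user \<Rightarrow> 'loc"
    and \<gamma> :: "'user \<Rightarrow> int \<Rightarrow> 'w \<Rightarrow> real"
    and U :: "'w \<Rightarrow> nat"
    and served :: "nat \<Rightarrow> 'user set"
    and W :: nat and \<tau> :: int and i :: 'user
  assumes station: "uplink_station M A p \<rho> loc \<gamma> U served"
    and load: "0 \<le> \<rho>" "\<rho> < 1"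
    and window: "1 \<le> W"
    and user: "\<And>u. 1 \<le> u \<Longrightarrow> i \<in> served u"
  shows "is_sched_prob M \<gamma> U served W \<tau> i (sched_prob M \<gamma> U served W \<tau> i) \<and>
    (\<forall>z\<ge>0. scheduled_density M U (sched_prob M \<gamma> U served W \<tau> i) (p (loc i)) z
       = p (loc i) z * (\<Sum>n=1..W. Q_coeff (p (loc i)) W n z * T_coeff \<rho> W n)) \<and>
    (\<forall>c. is_sched_prob M \<gamma> U served W \<tau> i c \<longrightarrow>
       (AE z in lborel. 0 \<le> z \<longrightarrow>
          scheduled_density M U c (p (loc i)) z
            = p (loc i) z * (\<Sum>n=1..W. Q_coeff (p (loc i)) W n z * T_coeff \<rho> W n)))"
proof -
  interpret uplink_station M A p \<rho> loc \<gamma> U served by (rule station)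
  have version: "is_sched_prob M \<gamma> U served W \<tau> i (sched_prob M \<gamma> U served W \<tau> i)"
    unfolding is_sched_prob_def using served_card user by (auto intro!: is_cond_prob_sched_prob window)
  have "AE z in lborel. 0 \<le> z \<longrightarrow> scheduled_density M U c (p (loc i)) z
      = p (loc i) z * (\<Sum>n=1..W. Q_coeff (p (loc i)) W n z * T_coeff \<rho> W n)"
    if c: "is_sched_prob M \<gamma> U served W \<tau> i c" for c
  proof -
    have "AE z in lborel. c u z * p (loc i) z = sched_prob M \<gamma> U served W \<tau> i u z * p (loc i) z"
      if "1 \<le> u" "prob {\<omega> \<in> space M. U \<omega> = u} \<noteq> 0" for u
      using cond_prob_version_unique[OF that(2)] c version that(1)
      unfolding is_sched_prob_def by blast
    \<comment> \<open>There are countably many \<open>u\<close>, so one null set serves them all, as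
      the sum over \<open>u\<close> requires.\<close>
    then have "AE z in lborel. \<forall>u. 1 \<le> u \<longrightarrow> prob {\<omega> \<in> space M. U \<omega> = u} \<noteq> 0 \<longrightarrow>
        c u z * p (loc i) z = sched_prob M \<gamma> U served W \<tau> i u z * p (loc i) z"
      by (simp add: AE_all_countable)
    then show ?thesis
    proof eventually_elim
      case (elim z)
      then show ?case by (intro impI scheduled_density_eq[where \<tau> = \<tau>, OF load window user])
        (assumption, rule elim(1)[rule_format])
    qed
  qed
  then show ?thesis
    using version scheduled_density_eq[where \<tau> = \<tau>, OF load window user] by blast
qed

end
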